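(* Let $G=(V,E)$ be a hypergraph and let $(V_1,\dots,V_k)$ be a maximal minimum $k$-partition in $G$ for an integer $k\ge 2$. Suppose $|V_1|\ge 2k-2$. Then for every subset $T\subseteq V\setminus V_1$ such that $T\cap V_j\neq\emptyset$ for every $j\in\{2,\dots,k\}$, there exists a subset $S\subseteq V_1$ with $|S|=2k-2$ such that $(V_1,V\setminus V_1)$ is the source maximal minimum $(S,T)$-terminal cut.
   Context: A hypergraph $G=(V,E)$ has a finite vertex set $V$ and a finite multiset $E$ of hyperedges (subsets of $V$); all hyperedges have unit cost. For $U\subseteq V$, $\overline{U}=V\setminus U$, and $d(U)$ is the number of hyperedges intersecting both $U$ and $\overline{U}$. For a partition $(P_1,\dots,P_h)$ of $V$ into non-empty sets (ordered tuple), $\mathrm{cost}(P_1,\dots,P_h)$ is the number of hyperedges intersecting at least two parts. A minimum $k$-partition is a $k$-partition of minimum cost. A minimum $k$-partition $(V_1,\dots,V_k)$ is a maximal minimum $k$-partition if there is no other minimum $k$-partition $(V_1',\dots,V_k')$ with $V_1\subsetneq V_1'$. For disjoint $S,T\subseteq V$, a 2-partition $(U,\overline{U})$ is an $(S,T)$-terminal cut if $S\subseteq U\subseteq V\setminus T$; it is a minimum $(S,T)$-terminal cut if $d(U)$ is minimum among all $(S,T)$-terminal cuts; the source maximal minimum $(S,T)$-terminal cut is the (unique) minimum $(S,T)$-terminal cut whose source set $U$ is inclusion-wise maximal. *)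

theory Defs
  imports Main "HOL-Library.Multiset"
begin

definition hypergraph :: "'a set \<Rightarrow> 'a set multiset \<Rightarrow> bool" where
  "hypergraph V E \<longleftrightarrow> finite V \<and> (\<forall>e\<in>#E. e \<subseteq> V)"

definition cut_val :: "'a set \<Rightarrow> 'a set multiset \<Rightarrow> 'a set \<Rightarrow> nat" where
  "cut_val V E U = size (filter_mset (\<lambda>e. e \<inter> U \<noteq> {} \<and> e \<inter> (V - U) \<noteq> {}) E)"

text \<open>An ordered h-partition (P_1,...,P_h) is the list [P_1,...,P_h] (0-indexed in Isabelle).\<close>
definition is_partition :: "'a set \<Rightarrow> nat \<Rightarrow> 'a set list \<Rightarrow> bool" where
  "is_partition V h P \<longleftrightarrow> length P = h \<and> (\<forall>i<h. P ! i \<noteq> {})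
     \<and> (\<forall>i<h. \<forall>j<h. i \<noteq> j \<longrightarrow> P ! i \<inter> P ! j = {}) \<and> \<Union> (set P) = V"

definition part_cost :: "'a set multiset \<Rightarrow> 'a set list \<Rightarrow> nat" where
  "part_cost E P = size (filter_mset
     (\<lambda>e. \<exists>i<length P. \<exists>j<length P. i \<noteq> j \<and> e \<inter> P ! i \<noteq> {} \<and> e \<inter> P ! j \<noteq> {}) E)"

definition min_kpart :: "'a set \<Rightarrow> 'a set multiset \<Rightarrow> nat \<Rightarrow> 'a set list \<Rightarrow> bool" where
  "min_kpart V E k P \<longleftrightarrow> is_partition V k P \<and>
     (\<forall>Q. is_partition V k Q \<longrightarrow> part_cost E P \<le> part_cost E Q)"

definition max_min_kpart :: "'a set \<Rightarrow> 'a set multiset \<Rightarrow> nat \<Rightarrow> 'a set list \<Rightarrow> bool" where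
  "max_min_kpart V E k P \<longleftrightarrow> min_kpart V E k P \<and>
     \<not> (\<exists>Q. min_kpart V E k Q \<and> P ! 0 \<subset> Q ! 0)"

text \<open>(U, V - U) is an (S,T)-terminal cut.\<close>
definition terminal_cut :: "'a set \<Rightarrow> 'a set \<Rightarrow> 'a set \<Rightarrow> 'a set \<Rightarrow> bool" where
  "terminal_cut V S T U \<longleftrightarrow> S \<subseteq> U \<and> U \<subseteq> V - T"

definition min_terminal_cut :: "'a set \<Rightarrow> 'a set multiset \<Rightarrow> 'a set \<Rightarrow> 'a set \<Rightarrow> 'a set \<Rightarrow> bool" where
  "min_terminal_cut V E S T U \<longleftrightarrow> terminal_cut V S T U \<and>
     (\<forall>U'. terminal_cut V S T U' \<longrightarrow> cut_val V E U \<le> cut_val V E U')"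

definition source_max_min_terminal_cut :: "'a set \<Rightarrow> 'a set multiset \<Rightarrow> 'a set \<Rightarrow> 'a set \<Rightarrow> 'a set \<Rightarrow> bool" where
  "source_max_min_terminal_cut V E S T U \<longleftrightarrow> min_terminal_cut V E S T U \<and>
     \<not> (\<exists>U'. min_terminal_cut V E S T U' \<and> U \<subset> U')"

end

theory Submission
  imports Defs
begin

text \<open>
  Write \<open>d\<close> for the cut function, \<open>U = V\<^sub>1\<close>, and call \<open>S \<subseteq> U\<close> good if \<open>d(X) \<ge> d(U)\<close> whenever
  \<open>S \<subseteq> X \<subseteq> U\<close>. Enlarging \<open>V\<^sub>1\<close> to \<open>X\<close> without swallowing \<open>T\<close> changes the partition cost by at most
  \<open>d(X) - d(U)\<close>, so maximality gives \<open>d(X) > d(U)\<close> for \<open>U \<subset> X \<subseteq> V - T\<close>; by submodularity every good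
  \<open>S\<close> then has \<open>U\<close> as its source maximal minimum cut, and it suffices to find a small good set.

  Let \<open>S\<close> be good of minimum size and suppose it has \<open>2k - 2\<close> elements \<open>u\<close>. Dropping \<open>u\<close> yields
  \<open>A\<^sub>u \<supseteq> V - U\<close> with \<open>A\<^sub>u \<inter> S = {u}\<close> and \<open>d(A\<^sub>u) < d(U)\<close>, whereas any set containing \<open>V - U\<close> and
  avoiding \<open>S\<close>, such as an intersection of several \<open>A\<^sub>u\<close>, has cut value at least \<open>d(U)\<close>. Uncross the
  \<open>A\<^sub>u\<close> one at a time and let \<open>Y\<^sub>u\<close> be the points lying in \<open>A\<^sub>u\<close> only. Splitting the indices into two
  halves of size \<open>k - 1\<close>, each half gives the \<open>k\<close>-partition formed by its \<open>Y\<^sub>u\<close> and the remaining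
  points, and the two costs add up to at most \<open>d(A\<^sub>a) + d(A\<^sub>b) < 2 d(U)\<close> for some \<open>a\<close>, \<open>b\<close>.
  So one of them costs less than \<open>d(U)\<close>, which is at most the optimum: a contradiction.
\<close>

section \<open>Crossing hyperedges, overlaps and exclusive parts of a family of sets\<close>

definition crosses :: "'a set \<Rightarrow> 'a set \<Rightarrow> bool" where
  "crosses e X \<longleftrightarrow> e \<inter> X \<noteq> {} \<and> \<not> e \<subseteq> X"

definition overlap :: "('i \<Rightarrow> 'a set) \<Rightarrow> 'i set \<Rightarrow> 'a set" where
  "overlap A J = {x. \<exists>u\<in>J. \<exists>v\<in>J. u \<noteq> v \<and> x \<in> A u \<and> x \<in> A v}"

definition exclusive :: "('i \<Rightarrow> 'a set) \<Rightarrow> 'i set \<Rightarrow> 'i \<Rightarrow> 'a set" where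
  "exclusive A J u = A u - \<Union> (A ` (J - {u}))"

definition spread :: "('i \<Rightarrow> 'a set) \<Rightarrow> 'i set \<Rightarrow> 'a set \<Rightarrow> bool" where
  "spread A J e \<longleftrightarrow> (\<exists>u\<in>J. \<exists>v\<in>J. u \<noteq> v \<and> e \<inter> exclusive A J u \<noteq> {} \<and> e \<inter> exclusive A J v \<noteq> {})"

text \<open>
  Potential of the uncrossing: the cut values of the union and of the overlap, increased by what
  submodularity gains on hyperedges that meet two exclusive parts.
\<close>
definition weight :: "('i \<Rightarrow> 'a set) \<Rightarrow> 'i set \<Rightarrow> 'a set \<Rightarrow> nat" where
  "weight A J e = (if spread A J e then 2
     else of_bool (crosses e (\<Union> (A ` J))) + of_bool (crosses e (overlap A J)))"

section \<open>The cut function as a sum over hyperedges, and its submodularity\<close>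

lemma size_filter_mset_eq_sum: "size (filter_mset Q M) = (\<Sum>x\<in>#M. of_bool (Q x))"
  by (induction M) auto

text \<open>Hyperedges lie in \<open>V\<close>, so \<open>crosses\<close> can do without
  \<open>V\<close>. In this form, inequalities between cut values can be checked one hyperedge at a
  time.\<close>

lemma cut_val_eq_sum:
  assumes "hypergraph V E"
  shows "cut_val V E X = (\<Sum>e\<in>#E. of_bool (crosses e X))"
proof -
  have "e \<inter> X \<noteq> {} \<and> e \<inter> (V - X) \<noteq> {} \<longleftrightarrow> crosses e X" if "e \<in># E" for e
    using assms that unfolding hypergraph_def crosses_def by blast
  then show ?thesis
    unfolding cut_val_def size_filter_mset_eq_sum
    by (intro arg_cong[of _ _ sum_mset] image_mset_cong) simp
qed

lemma cut_val_compl: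
  assumes "X \<subseteq> V"
  shows "cut_val V E (V - X) = cut_val V E X"
  using double_diff[OF assms order_refl] unfolding cut_val_def by (simp add: conj_commute)

lemma crosses_submodular:
  "of_bool (crosses e (X \<union> Y)) + of_bool (crosses e (X \<inter> Y))
    \<le> (of_bool (crosses e X) + of_bool (crosses e Y) :: nat)"
proof -
  have "crosses e (X \<union> Y) \<or> crosses e (X \<inter> Y) \<Longrightarrow> crosses e X \<or> crosses e Y"
    "crosses e (X \<union> Y) \<and> crosses e (X \<inter> Y) \<Longrightarrow> crosses e X \<and> crosses e Y"
    unfolding crosses_def by blast+
  then show ?thesis by (auto simp: of_bool_def)
qed

lemma cut_val_submodular:
  assumes "hypergraph V E"
  shows "cut_val V E (X \<union> Y) + cut_val V E (X \<inter> Y) \<le> cut_val V E X + cut_val V E Y"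
  unfolding cut_val_eq_sum[OF assms] sum_mset.distrib[symmetric]
  by (intro sum_mset_mono crosses_submodular)

section \<open>Uncrossing a family one set at a time\<close>

lemma overlap_insert:
  "v \<notin> J \<Longrightarrow> overlap A (insert v J) = overlap A J \<union> (\<Union> (A ` J) \<inter> A v)"
  unfolding overlap_def by auto

lemma overlap_subset: "overlap A J \<subseteq> \<Union> (A ` J)"
  unfolding overlap_def by blast

lemma exclusive_insert_old:
  "v \<notin> J \<Longrightarrow> u \<in> J \<Longrightarrow> exclusive A (insert v J) u = exclusive A J u - A v"
  unfolding exclusive_def by blast

lemma exclusive_insert_new:
  "v \<notin> J \<Longrightarrow> exclusive A (insert v J) v = A v - \<Union> (A ` J)"
  unfolding exclusive_def by blast

lemma exclusive_disjoint:
  "u \<in> J \<Longrightarrow> v \<in> J \<Longrightarrow> u \<noteq> v \<Longrightarrow> exclusive A J u \<inter> exclusive A J v = {}"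
  unfolding exclusive_def by blast

lemma exclusive_overlap_disjoint: "u \<in> J \<Longrightarrow> exclusive A J u \<inter> overlap A J = {}"
  unfolding exclusive_def overlap_def by blast

lemma exclusive_subset: "exclusive A J u \<subseteq> A u"
  unfolding exclusive_def by blast

lemma Union_exclusive_overlap: "\<Union> (A ` J) = \<Union> (exclusive A J ` J) \<union> overlap A J"
  unfolding exclusive_def overlap_def by blast

lemma weight_le_2: "weight A J e \<le> 2"
  unfolding weight_def by (auto simp: of_bool_def)

lemma weight_ge:
  "of_bool (crosses e (\<Union> (A ` J))) + of_bool (crosses e (overlap A J)) \<le> weight A J e"
  unfolding weight_def by (auto simp: of_bool_def)

text \<open>One uncrossing step for a single hyperedge. Submodularity applied twice settles it
  unless the hyperedge is spread over the new family. In that case the new weight is 2 and must be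
  paid for by the right-hand side.\<close>

lemma weight_insert:
  assumes "v \<notin> J"
  shows "weight A (insert v J) e + of_bool (crosses e (overlap A J \<inter> A v))
    \<le> weight A J e + of_bool (crosses e (A v))"
proof -
  define U W B where "U = \<Union> (A ` J)" and "W = overlap A J" and "B = A v"
  have U': "\<Union> (A ` insert v J) = U \<union> B" and W': "overlap A (insert v J) = W \<union> (U \<inter> B)"
    and WU: "W \<subseteq> U"
    using assms by (auto simp: U_def W_def B_def overlap_insert overlap_subset dest: overlap_subset[THEN subsetD])
  consider (old) u w where "u \<in> J" "w \<in> J" "u \<noteq> w"
      "e \<inter> (exclusive A J u - B) \<noteq> {}" "e \<inter> (exclusive A J w - B) \<noteq> {}"
    | (new) u where "u \<in> J" "e \<inter> (exclusive A J u - B) \<noteq> {}" "e \<inter> (B - U) \<noteq> {}"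
    | (none) "\<not> spread A (insert v J) e"
  proof (cases "spread A (insert v J) e")
    case True
    then obtain u w where uw: "u \<in> insert v J" "w \<in> insert v J" "u \<noteq> w"
      "e \<inter> exclusive A (insert v J) u \<noteq> {}" "e \<inter> exclusive A (insert v J) w \<noteq> {}"
      unfolding spread_def by blast
    have o: "exclusive A (insert v J) x = exclusive A J x - B" if "x \<in> J" for x
      using that assms exclusive_insert_old unfolding B_def by metis
    have n: "exclusive A (insert v J) v = B - U"
      using assms exclusive_insert_new unfolding B_def U_def by metis
    consider "u \<in> J" "w \<in> J" | "u = v" "w \<in> J" | "u \<in> J" "w = v" using uw by blast
    then show thesis using old[of u w] new[of u] new[of w] uw o n by cases simp_all
  qed (rule none)
  then show ?thesis
  proof cases
    \<comment> \<open>Both exclusive parts were already met before \<open>v\<close> was added, so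
      the old weight is 2 as well. A point outside \<open>B\<close> turns a crossing of
      \<open>W \<inter> B\<close> into one of \<open>B\<close>.\<close>
    case old
    then have "spread A J e" unfolding spread_def by blast
    then have "weight A J e = 2" by (simp add: weight_def)
    moreover have "crosses e (W \<inter> B) \<longrightarrow> crosses e B"
      using old unfolding crosses_def by blast
    ultimately show ?thesis
      using weight_le_2[of A "insert v J" e] unfolding W_def B_def by (auto simp: of_bool_def)
  next
    \<comment> \<open>The hyperedge has a point of \<open>U - B\<close> and one of
      \<open>B - U\<close>, so it crosses both \<open>U\<close> and \<open>B\<close>, which pays for
      the 2. Its point in \<open>exclusive A J u\<close> lies outside \<open>W\<close>.\<close>
    case new
    have u: "exclusive A J u \<subseteq> U" "exclusive A J u \<inter> W = {}"
      using new(1) exclusive_subset[of A J u] exclusive_overlap_disjoint[of u J A]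
      unfolding U_def W_def by blast+
    have "crosses e U" "crosses e B" "crosses e (W \<inter> B) \<longrightarrow> crosses e W"
      using new u unfolding crosses_def by blast+
    then show ?thesis
      using weight_le_2[of A "insert v J" e] weight_ge[of e A J]
      unfolding U_def W_def B_def by (auto simp: of_bool_def split: if_splits)
  next
    case none
    then have w': "weight A (insert v J) e = of_bool (crosses e (U \<union> B)) + of_bool (crosses e (W \<union> (U \<inter> B)))"
      unfolding weight_def U' W' by simp
    \<comment> \<open>Uncross \<open>U\<close> with \<open>B\<close>, then \<open>W\<close> with
      \<open>U \<inter> B\<close>. The term for \<open>U \<inter> B\<close> cancels, and
      \<open>W \<subseteq> U\<close> reduces the second intersection to
      \<open>W \<inter> B\<close>.\<close>
    have "of_bool (crosses e (U \<union> B)) + of_bool (crosses e (U \<inter> B))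
        \<le> (of_bool (crosses e U) + of_bool (crosses e B) :: nat)"
      by (rule crosses_submodular)
    moreover have "of_bool (crosses e (W \<union> (U \<inter> B))) + of_bool (crosses e (W \<inter> B))
        \<le> (of_bool (crosses e W) + of_bool (crosses e (U \<inter> B)) :: nat)"
      using crosses_submodular[of e W "U \<inter> B"] WU by (simp add: Int_absorb2 flip: Int_assoc)
    ultimately show ?thesis
      using w' weight_ge[of e A J] unfolding U_def[symmetric] W_def[symmetric] B_def[symmetric]
      by linarith
  qed
qed

lemma sum_weight_insert:
  assumes "hypergraph V E" "v \<notin> J"
  shows "(\<Sum>e\<in>#E. weight A (insert v J) e) + cut_val V E (overlap A J \<inter> A v)
    \<le> (\<Sum>e\<in>#E. weight A J e) + cut_val V E (A v)"
  unfolding cut_val_eq_sum[OF assms(1)] sum_mset.distrib[symmetric]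
  by (intro sum_mset_mono weight_insert assms(2))

text \<open>The first two sets pay their cut values; every later \<open>A v\<close> is free, because
  what it adds is returned by the cut value of \<open>overlap A K \<inter> A v\<close>. Requiring
  \<open>a\<close> and \<open>b\<close> in \<open>K\<close> ensures that the overlap contains
  \<open>A a \<inter> A b\<close>.\<close>

lemma sum_weight_le:
  assumes H: "hypergraph V E" and "finite J" and "a \<notin> J" "b \<notin> J" "a \<noteq> b"
    and "\<And>v K. v \<in> J \<Longrightarrow> K \<subseteq> insert a (insert b J) \<Longrightarrow> a \<in> K \<Longrightarrow> b \<in> K \<Longrightarrow> v \<notin> K \<Longrightarrow>
      cut_val V E (A v) \<le> cut_val V E (overlap A K \<inter> A v)"
  shows "(\<Sum>e\<in>#E. weight A (insert a (insert b J)) e) \<le> cut_val V E (A a) + cut_val V E (A b)"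
  using assms(2-)
proof (induction J)
  case empty
  have "(\<Sum>e\<in>#E. weight A {} e) = 0"
    by (simp add: weight_def spread_def crosses_def overlap_def)
  then show ?case
    using sum_weight_insert[OF H, of b "{}" A] sum_weight_insert[OF H, of a "{b}" A] \<open>a \<noteq> b\<close>
    by (simp del: sum_mset_0_iff)
next
  case (insert v J)
  let ?K = "insert a (insert b J)"
  have "(\<Sum>e\<in>#E. weight A ?K e) \<le> cut_val V E (A a) + cut_val V E (A b)"
    by (rule insert.IH) (use insert.prems in auto)
  moreover have "cut_val V E (A v) \<le> cut_val V E (overlap A ?K \<inter> A v)"
    using insert.prems insert.hyps by (intro insert.prems(4)) auto
  moreover have "(\<Sum>e\<in>#E. weight A (insert v ?K) e) + cut_val V E (overlap A ?K \<inter> A v)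
    \<le> (\<Sum>e\<in>#E. weight A ?K e) + cut_val V E (A v)"
    using insert.prems insert.hyps by (intro sum_weight_insert[OF H]) auto
  ultimately show ?case by (simp add: insert_commute)
qed

section \<open>Partitions built from exclusive parts, and their cost\<close>

definition star_partition :: "'a set \<Rightarrow> ('i \<Rightarrow> 'a set) \<Rightarrow> 'i list \<Rightarrow> 'a set list" where
  "star_partition V Y us = (V - \<Union> (Y ` set us)) # map Y us"

lemma is_partition_star_partition:
  assumes "distinct us" "\<And>u. u \<in> set us \<Longrightarrow> Y u \<noteq> {} \<and> Y u \<subseteq> V"
    "\<And>u v. u \<in> set us \<Longrightarrow> v \<in> set us \<Longrightarrow> u \<noteq> v \<Longrightarrow> Y u \<inter> Y v = {}"
    "V - \<Union> (Y ` set us) \<noteq> {}"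
  shows "is_partition V (Suc (length us)) (star_partition V Y us)"
  unfolding is_partition_def star_partition_def
proof (intro conjI allI impI)
  fix i assume "i < Suc (length us)"
  then show "((V - \<Union> (Y ` set us)) # map Y us) ! i \<noteq> {}"
    using assms(2,4) by (cases i) auto
next
  fix i j assume "i < Suc (length us)" "j < Suc (length us)" "i \<noteq> j"
  moreover have "(V - \<Union> (Y ` set us)) \<inter> Y (us ! l) = {}" if "l < length us" for l
    using that nth_mem by blast
  moreover have "Y (us ! l) \<inter> Y (us ! m) = {}" if "l < length us" "m < length us" "l \<noteq> m" for l m
    using that assms(1,3) by (simp add: nth_eq_iff_index_eq)
  ultimately show "((V - \<Union> (Y ` set us)) # map Y us) ! i \<inter> ((V - \<Union> (Y ` set us)) # map Y us) ! j = {}"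
    by (cases i; cases j) (auto simp: Int_commute)
next
  show "\<Union> (set ((V - \<Union> (Y ` set us)) # map Y us)) = V"
    using assms(2) by auto
qed simp

text \<open>Of any two different parts, at least one is some \<open>Y u\<close>. A hyperedge meeting
  both also leaves that \<open>Y u\<close>, since the parts are disjoint.\<close>

lemma part_cost_star_partition_le:
  assumes "distinct us"
    and "\<And>u v. u \<in> set us \<Longrightarrow> v \<in> set us \<Longrightarrow> u \<noteq> v \<Longrightarrow> Y u \<inter> Y v = {}"
  shows "part_cost E (star_partition V Y us) \<le> (\<Sum>e\<in>#E. of_bool (\<exists>u\<in>set us. crosses e (Y u)))"
  unfolding part_cost_def size_filter_mset_eq_sum
proof (intro sum_mset_mono)
  fix e
  let ?P = "star_partition V Y us"
  have "\<exists>u\<in>set us. crosses e (Y u)"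
    if ij: "i < length ?P" "j < length ?P" "i \<noteq> j" "e \<inter> ?P ! i \<noteq> {}" "e \<inter> ?P ! j \<noteq> {}" for i j
  proof -
    \<comment> \<open>The set \<open>Y (us ! l)\<close> sits at position \<open>Suc l\<close>,
      because position 0 holds the remaining points.\<close>
    have *: ?thesis if "e \<inter> Y (us ! l) \<noteq> {}" "l < length us"
        "e \<inter> ?P ! m \<noteq> {}" "m < length ?P" "m \<noteq> Suc l" for l m
    proof -
      have "us ! l \<in> set us" using that by simp
      moreover have "?P ! m \<inter> Y (us ! l) = {}"
      proof (cases m)
        case 0
        then show ?thesis using \<open>us ! l \<in> set us\<close> by (auto simp: star_partition_def)
      next
        case (Suc n)
        then have "us ! n \<noteq> us ! l" "us ! n \<in> set us"
          using that assms(1) by (auto simp: nth_eq_iff_index_eq star_partition_def)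
        then show ?thesis
          using Suc that assms(2)[of "us ! n" "us ! l"] \<open>us ! l \<in> set us\<close> by (simp add: star_partition_def)
      qed
      ultimately show ?thesis using that(1,3) unfolding crosses_def by blast
    qed
    show ?thesis
    proof (cases i)
      case 0
      then obtain n where "j = Suc n" using ij(3) by (cases j) auto
      then show ?thesis using *[of n i] ij by (simp add: star_partition_def)
    next
      case (Suc n)
      then show ?thesis using *[of n j] ij by (simp add: star_partition_def)
    qed
  qed
  then show "(of_bool (\<exists>i<length ?P. \<exists>j<length ?P. i \<noteq> j \<and> e \<inter> ?P ! i \<noteq> {} \<and> e \<inter> ?P ! j \<noteq> {}) :: nat)
      \<le> of_bool (\<exists>u\<in>set us. crosses e (Y u))"
    by (auto simp: of_bool_def)
qed

text \<open>A spread hyperedge has weight 2, which always suffices. Any other crosses at most one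
  exclusive part, hence counts for only one of \<open>I\<close> and \<open>J\<close>. It leaves that
  part for the overlap or for the outside of the union, so it crosses one of these and has weight at
  least 1.\<close>

lemma crosses_exclusive_le_weight:
  assumes "I \<subseteq> K" "J \<subseteq> K" "I \<inter> J = {}"
  shows "of_bool (\<exists>u\<in>I. crosses e (exclusive A K u)) + of_bool (\<exists>u\<in>J. crosses e (exclusive A K u))
    \<le> weight A K e"
proof (cases "spread A K e")
  case True
  then show ?thesis by (auto simp: weight_def of_bool_def)
next
  case False
  have 1: "1 \<le> weight A K e" if u: "u \<in> K" "crosses e (exclusive A K u)" for u
  proof -
    obtain x where x: "x \<in> e" "x \<notin> exclusive A K u" using u unfolding crosses_def by blast
    have "x \<notin> exclusive A K v" if "v \<in> K" for v
      using False x u that unfolding spread_def crosses_def by (cases "v = u") blast+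
    then have "x \<in> overlap A K \<or> x \<notin> \<Union> (A ` K)"
      using Union_exclusive_overlap[of A K] by blast
    then have "crosses e (overlap A K) \<or> crosses e (\<Union> (A ` K))"
      using u x(1) exclusive_overlap_disjoint[of u K A] exclusive_subset[of A K u]
      unfolding crosses_def by blast
    then show ?thesis using weight_ge[of e A K] by auto
  qed
  have "\<not> ((\<exists>u\<in>I. crosses e (exclusive A K u)) \<and> (\<exists>u\<in>J. crosses e (exclusive A K u)))"
  proof
    assume "(\<exists>u\<in>I. crosses e (exclusive A K u)) \<and> (\<exists>u\<in>J. crosses e (exclusive A K u))"
    then obtain u v where uv: "u \<in> I" "v \<in> J" "crosses e (exclusive A K u)" "crosses e (exclusive A K v)"
      by blast
    then have "u \<noteq> v" "u \<in> K" "v \<in> K" using assms by blast+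
    then show False using False uv unfolding spread_def crosses_def by blast
  qed
  then show ?thesis using 1 assms by (auto simp: of_bool_def)
qed

lemma star_partitions_cost_le:
  assumes "distinct us" "distinct vs" "set us \<subseteq> K" "set vs \<subseteq> K" "set us \<inter> set vs = {}"
  shows "part_cost E (star_partition V (exclusive A K) us)
      + part_cost E (star_partition V (exclusive A K) vs) \<le> (\<Sum>e\<in>#E. weight A K e)"
proof -
  let ?c = "\<lambda>ws. \<Sum>e\<in>#E. of_bool (\<exists>u\<in>set ws. crosses e (exclusive A K u)) :: nat"
  have "part_cost E (star_partition V (exclusive A K) ws) \<le> ?c ws"
    if "distinct ws" "set ws \<subseteq> K" for ws
    using that by (intro part_cost_star_partition_le exclusive_disjoint) auto
  then have "part_cost E (star_partition V (exclusive A K) us)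
      + part_cost E (star_partition V (exclusive A K) vs) \<le> ?c us + ?c vs"
    using assms by (intro add_mono) auto
  also have "\<dots> \<le> (\<Sum>e\<in>#E. weight A K e)"
    unfolding sum_mset.distrib[symmetric]
    by (intro sum_mset_mono crosses_exclusive_le_weight assms)
  finally show ?thesis .
qed

section \<open>Cut values around the first part of a partition, and terminal cuts\<close>

lemma cut_val_le_part_cost:
  assumes "is_partition V k P" "0 < k"
  shows "cut_val V E (P ! 0) \<le> part_cost E P"
  unfolding part_cost_def cut_val_def size_filter_mset_eq_sum
proof (intro sum_mset_mono)
  fix e
  have "\<exists>i<length P. \<exists>j<length P. i \<noteq> j \<and> e \<inter> P ! i \<noteq> {} \<and> e \<inter> P ! j \<noteq> {}"
    if e: "e \<inter> P ! 0 \<noteq> {}" "e \<inter> (V - P ! 0) \<noteq> {}"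
  proof -
    obtain x where x: "x \<in> e" "x \<in> V" "x \<notin> P ! 0" using e by blast
    then obtain j where "j < length P" "x \<in> P ! j"
      using assms(1) unfolding is_partition_def by (metis UnionE in_set_conv_nth)
    then show ?thesis using x e assms unfolding is_partition_def by (metis disjoint_iff)
  qed
  then show "(of_bool (e \<inter> P ! 0 \<noteq> {} \<and> e \<inter> (V - P ! 0) \<noteq> {}) :: nat) \<le>
      of_bool (\<exists>i<length P. \<exists>j<length P. i \<noteq> j \<and> e \<inter> P ! i \<noteq> {} \<and> e \<inter> P ! j \<noteq> {})"
    by (auto simp: of_bool_def)
qed

text \<open>The points of \<open>X\<close> are moved from the other parts to the first one. The cost
  bound is checked for each hyperedge, from facts \<open>a\<close> and \<open>b\<close>
  below.\<close>

lemma enlarge_first_part: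
  assumes H: "hypergraph V E" and P: "is_partition V k P" and k: "0 < k"
    and X: "P ! 0 \<subseteq> X" "X \<subseteq> V" and ne: "\<And>j. 0 < j \<Longrightarrow> j < k \<Longrightarrow> P ! j - X \<noteq> {}"
  obtains Q where "is_partition V k Q" "Q ! 0 = X"
    "part_cost E Q + cut_val V E (P ! 0) \<le> part_cost E P + cut_val V E X"
proof
  define Q where "Q = X # map (\<lambda>B. B - X) (tl P)"
  have len: "length P = k" and disj: "\<And>i j. i < k \<Longrightarrow> j < k \<Longrightarrow> i \<noteq> j \<Longrightarrow> P ! i \<inter> P ! j = {}"
    and neP: "\<And>i. i < k \<Longrightarrow> P ! i \<noteq> {}" and UnP: "\<Union> (set P) = V"
    using P unfolding is_partition_def by blast+
  have lenQ: "length Q = k" using len k by (simp add: Q_def)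
  have Q0: "Q ! 0 = X" by (simp add: Q_def)
  have Qj: "Q ! j = P ! j - X" if "0 < j" "j < k" for j
    using that len by (cases j) (auto simp: Q_def nth_tl)
  show "Q ! 0 = X" by (rule Q0)
  have memP: "\<exists>j<k. x \<in> P ! j" if "x \<in> V" for x
    using that UnP len by (metis UnionE in_set_conv_nth)
  show "is_partition V k Q"
    unfolding is_partition_def
  proof (intro conjI allI impI lenQ)
    fix i assume "i < k"
    then show "Q ! i \<noteq> {}" using ne[of i] Qj[of i] Q0 X(1) neP[of 0] k by (cases "i = 0") auto
  next
    fix i j assume "i < k" "j < k" "i \<noteq> j"
    then show "Q ! i \<inter> Q ! j = {}"
      using Q0 Qj disj[of i j] by (cases "i = 0"; cases "j = 0") auto
  next
    have "x \<in> \<Union> (set Q)" if xV: "x \<in> V" for x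
    proof (cases "x \<in> X")
      case True
      then show ?thesis by (simp add: Q_def)
    next
      case False
      obtain j where "j < k" "x \<in> P ! j" using memP[OF xV] by blast
      moreover then have "0 < j" using False X(1) by (cases j) auto
      ultimately have "x \<in> Q ! j" "j < length Q" using Qj lenQ False by auto
      then show ?thesis using nth_mem by blast
    qed
    moreover have "\<Union> (set Q) \<subseteq> V"
      using UnP X(2) set_drop_subset[of 1 P] by (auto simp: Q_def drop_Suc)
    ultimately show "\<Union> (set Q) = V" by blast
  qed
  show "part_cost E Q + cut_val V E (P ! 0) \<le> part_cost E P + cut_val V E X"
    unfolding part_cost_def cut_val_eq_sum[OF H] size_filter_mset_eq_sum sum_mset.distrib[symmetric] lenQ len
  proof (intro sum_mset_mono)
    fix e assume "e \<in># E"
    then have eV: "e \<subseteq> V" using H unfolding hypergraph_def by blast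
    let ?c = "\<lambda>P. \<exists>i<k. \<exists>j<k. i \<noteq> j \<and> e \<inter> P ! i \<noteq> {} \<and> e \<inter> P ! j \<noteq> {}"
    have a: "?c P" if cr: "crosses e (P ! 0)"
    proof -
      obtain x where "x \<in> e" "x \<notin> P ! 0" using cr unfolding crosses_def by blast
      moreover then obtain j where "j < k" "x \<in> P ! j" using memP eV by blast
      ultimately show ?thesis using cr k unfolding crosses_def by (metis disjoint_iff)
    qed
    have b: "crosses e X \<or> ?c P \<and> \<not> crosses e (P ! 0)" if cQ: "?c Q"
    proof (cases "crosses e X")
      case False
      obtain i j where ij: "i < k" "j < k" "i \<noteq> j" "e \<inter> Q ! i \<noteq> {}" "e \<inter> Q ! j \<noteq> {}" using cQ by blast
      \<comment> \<open>Position 0 of \<open>Q\<close> is \<open>X\<close>, so meeting it together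
        with another part would mean crossing \<open>X\<close>. Hence both parts lie outside
        \<open>X\<close>, and the hyperedge misses \<open>X\<close> and with it
        \<open>P ! 0\<close>.\<close>
      have "0 < i \<and> 0 < j"
      proof (rule ccontr)
        assume "\<not> (0 < i \<and> 0 < j)"
        then have "crosses e X" using ij Q0 Qj unfolding crosses_def by (cases "i = 0") auto
        then show False using False by blast
      qed
      then have "e \<inter> (P ! i - X) \<noteq> {}" "e \<inter> (P ! j - X) \<noteq> {}" using ij Qj by auto
      moreover from this have "e \<inter> X = {}" using False unfolding crosses_def by blast
      ultimately show ?thesis using ij X(1) unfolding crosses_def by blast
    qed simp
    show "of_bool (?c Q) + of_bool (crosses e (P ! 0)) \<le> (of_bool (?c P) + of_bool (crosses e X) :: nat)"
      using a b by (cases "?c Q"; cases "crosses e (P ! 0)"; cases "?c P"; cases "crosses e X") simp_all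
  qed
qed

lemma cut_val_less_of_superset:
  assumes "hypergraph V E" "0 < k" "max_min_kpart V E k P" "P ! 0 \<subset> X" "X \<subseteq> V - T"
    "\<forall>j\<in>{1..<k}. T \<inter> P ! j \<noteq> {}"
  shows "cut_val V E (P ! 0) < cut_val V E X"
proof (rule ccontr)
  assume le: "\<not> ?thesis"
  have P: "is_partition V k P" "\<And>Q. is_partition V k Q \<Longrightarrow> part_cost E P \<le> part_cost E Q"
    and mx: "\<not> (\<exists>Q. min_kpart V E k Q \<and> P ! 0 \<subset> Q ! 0)"
    using assms(3) unfolding max_min_kpart_def min_kpart_def by blast+
  \<comment> \<open>As \<open>X\<close> avoids \<open>T\<close>, the points of \<open>T\<close> in a
    part stay there, so no part is emptied.\<close>
  have "P ! j - X \<noteq> {}" if "0 < j" "j < k" for j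
  proof -
    have "T \<inter> P ! j \<noteq> {}" using assms(6) that by simp
    then show ?thesis using assms(5) by blast
  qed
  then obtain Q where Q: "is_partition V k Q" "Q ! 0 = X"
    "part_cost E Q + cut_val V E (P ! 0) \<le> part_cost E P + cut_val V E X"
    using enlarge_first_part[OF assms(1) P(1) assms(2), of X] assms(4,5) by blast
  then have "part_cost E Q \<le> part_cost E P" using le by simp
  then have "min_kpart V E k Q" using P(2) Q(1) unfolding min_kpart_def by (meson order_trans)
  then show False using mx Q(2) assms(4) by blast
qed

text \<open>For a terminal cut \<open>X\<close>, the set \<open>X \<inter> U\<close> falls under
  \<open>sub\<close>, and \<open>X \<union> U\<close> is \<open>U\<close> or falls under
  \<open>sup\<close>. Submodularity then gives minimality of \<open>U\<close>; strictness in
  \<open>sup\<close> gives maximality.\<close>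

lemma source_max_min_terminal_cutI:
  assumes H: "hypergraph V E" and S: "S \<subseteq> U" and U: "U \<subseteq> V - T"
    and sub: "\<And>X. S \<subseteq> X \<Longrightarrow> X \<subseteq> U \<Longrightarrow> cut_val V E U \<le> cut_val V E X"
    and sup: "\<And>X. U \<subset> X \<Longrightarrow> X \<subseteq> V - T \<Longrightarrow> cut_val V E U < cut_val V E X"
  shows "source_max_min_terminal_cut V E S T U"
proof -
  have "cut_val V E U \<le> cut_val V E X" if X: "S \<subseteq> X" "X \<subseteq> V - T" for X
  proof -
    have "cut_val V E U \<le> cut_val V E (X \<inter> U)" using X S by (intro sub) auto
    moreover have "cut_val V E U \<le> cut_val V E (X \<union> U)"
    proof (cases "X \<union> U = U")
      case False
      then have "U \<subset> X \<union> U" by blast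
      then show ?thesis using sup[of "X \<union> U"] X U by simp
    qed simp
    ultimately show ?thesis using cut_val_submodular[OF H, of X U] by linarith
  qed
  then have "min_terminal_cut V E S T U"
    using S U unfolding min_terminal_cut_def terminal_cut_def by blast
  moreover have "\<not> min_terminal_cut V E S T X" if "U \<subset> X" for X
    using sup[OF that] S U unfolding min_terminal_cut_def terminal_cut_def by (meson not_le)
  ultimately show ?thesis unfolding source_max_min_terminal_cut_def by blast
qed

section \<open>Size of a critical witness set, and the theorem\<close>

lemma min_kpart_witness_card:
  assumes H: "hypergraph V E" and k: "2 \<le> k" and P: "min_kpart V E k P"
    and S: "S \<subseteq> P ! 0"
    and all: "\<And>X. S \<subseteq> X \<Longrightarrow> X \<subseteq> P ! 0 \<Longrightarrow> cut_val V E (P ! 0) \<le> cut_val V E X"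
    and crit: "\<And>u. u \<in> S \<Longrightarrow> \<exists>X. S - {u} \<subseteq> X \<and> X \<subseteq> P ! 0 \<and> cut_val V E X < cut_val V E (P ! 0)"
  shows "card S < 2 * k - 2"
proof (rule ccontr)
  assume "\<not> card S < 2 * k - 2"
  then obtain K where K: "K \<subseteq> S" "card K = 2 * k - 2" "finite K"
    using obtain_subset_with_card_n[of "2 * k - 2" S] by auto
  let ?U = "P ! 0"
  have part: "is_partition V k P" and opt: "\<And>Q. is_partition V k Q \<Longrightarrow> part_cost E P \<le> part_cost E Q"
    using P unfolding min_kpart_def by blast+
  have "?U \<in> set P" using part k unfolding is_partition_def by simp
  then have UV: "?U \<subseteq> V" using part unfolding is_partition_def by blast
  have "P ! 1 \<in> set P" "P ! 1 \<noteq> {}" "P ! 0 \<inter> P ! 1 = {}"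
    using part k unfolding is_partition_def by auto
  \<comment> \<open>This point will lie in every \<open>A u\<close>, hence in no exclusive part; it
    keeps the remainder of the star partitions non-empty.\<close>
  then obtain z where z: "z \<in> V" "z \<notin> ?U" using part unfolding is_partition_def by blast
  obtain X where X: "\<And>u. u \<in> S \<Longrightarrow> S - {u} \<subseteq> X u \<and> X u \<subseteq> ?U \<and> cut_val V E (X u) < cut_val V E ?U"
    using crit by metis
  define A where "A = (\<lambda>u. V - X u)"
  have uX: "u \<notin> X u" if "u \<in> S" for u
  proof
    assume "u \<in> X u"
    then have "S \<subseteq> X u" using X[OF that] by blast
    then show False using all[of "X u"] X[OF that] by simp
  qed
  have AK: "u \<in> A v \<longleftrightarrow> u = v" if "u \<in> S" "v \<in> S" for u v
    using that X[of v] uX[of v] S UV unfolding A_def by blast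
  have UA: "V - ?U \<subseteq> A u" if "u \<in> S" for u using X[OF that] unfolding A_def by blast
  have AV: "A u \<subseteq> V" for u unfolding A_def by blast
  have dA: "cut_val V E (A u) < cut_val V E ?U" if "u \<in> S" for u
    using cut_val_compl[of "X u" V E] X[OF that] UV unfolding A_def by (metis subset_trans)
  \<comment> \<open>The complement of such a \<open>W\<close> lies between \<open>S\<close> and
    \<open>?U\<close>, so \<open>all\<close> applies to it.\<close>
  have dW: "cut_val V E ?U \<le> cut_val V E W" if "V - ?U \<subseteq> W" "W \<subseteq> V" "W \<inter> S = {}" for W
  proof -
    have "S \<subseteq> V - W" "V - W \<subseteq> ?U" using that S UV by blast+
    then show ?thesis using all[of "V - W"] cut_val_compl[OF that(2)] by simp
  qed
  obtain us where us: "distinct us" "set us = K" using finite_distinct_list[OF K(3)] by blast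
  have lus: "length us = 2 * k - 2" using us K(2) distinct_card by fastforce
  \<comment> \<open>Since \<open>2 * k - 2\<close> is at least 2, there are two indices to start the
    uncrossing.\<close>
  have "\<exists>a b J. K = insert a (insert b J) \<and> a \<noteq> b \<and> a \<notin> J \<and> b \<notin> J \<and> finite J"
  proof -
    obtain a b where ab: "a \<in> K" "b \<in> K" "a \<noteq> b"
      using K(2) k card_le_Suc0_iff_eq[OF K(3)] by force
    show ?thesis
      by (rule exI[of _ a], rule exI[of _ b], rule exI[of _ "K - {a, b}"]) (use ab K in auto)
  qed
  then obtain a b J where J: "K = insert a (insert b J)" "a \<noteq> b" "a \<notin> J" "b \<notin> J" "finite J" by blast
  have "(\<Sum>e\<in>#E. weight A K e) \<le> cut_val V E (A a) + cut_val V E (A b)"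
    unfolding J(1)
  proof (rule sum_weight_le[OF H J(5,3,4,2)])
    fix v L assume v: "v \<in> J" and L: "L \<subseteq> insert a (insert b J)" "a \<in> L" "b \<in> L" "v \<notin> L"
    have "cut_val V E ?U \<le> cut_val V E (overlap A L \<inter> A v)"
    proof (rule dW)
      show "V - ?U \<subseteq> overlap A L \<inter> A v"
        using UA[of a] UA[of b] UA[of v] L v J K(1) unfolding overlap_def by blast
      show "overlap A L \<inter> A v \<subseteq> V" using AV by blast
      \<comment> \<open>By \<open>AK\<close>, a point of \<open>S\<close> lies in only one set
        \<open>A u\<close> with \<open>u\<close> in \<open>S\<close>, so it is never covered
        twice.\<close>
      show "(overlap A L \<inter> A v) \<inter> S = {}"
      proof -
        have False if x: "x \<in> S" "x \<in> overlap A L" for x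
        proof -
          obtain u w where uw: "u \<in> L" "w \<in> L" "u \<noteq> w" "x \<in> A u" "x \<in> A w"
            using x(2) unfolding overlap_def by blast
          then have "u \<in> S" "w \<in> S" using L(1) J(1) K(1) by blast+
          then show False using AK[OF x(1)] uw by blast
        qed
        then show ?thesis by blast
      qed
    qed
    then show "cut_val V E (A v) \<le> cut_val V E (overlap A L \<inter> A v)"
      using dA[of v] v J(1) K(1) by auto
  qed
  then have lt: "(\<Sum>e\<in>#E. weight A K e) < 2 * cut_val V E ?U"
    using dA[of a] dA[of b] J(1) K(1) by auto
  have star: "part_cost E P \<le> part_cost E (star_partition V (exclusive A K) ws)"
    if ws: "distinct ws" "set ws \<subseteq> K" "length ws = k - 1" for ws
  proof -
    have "is_partition V (Suc (length ws)) (star_partition V (exclusive A K) ws)"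
    proof (rule is_partition_star_partition[OF ws(1)])
      fix u assume "u \<in> set ws"
      then have "u \<in> S" using ws(2) K(1) by blast
      \<comment> \<open>Each index is its own witness: \<open>u\<close> belongs to
        \<open>A u\<close> and to no other set of the family.\<close>
      then have "u \<in> exclusive A K u" using AK[OF \<open>u \<in> S\<close>] K(1) unfolding exclusive_def by auto
      then show "exclusive A K u \<noteq> {} \<and> exclusive A K u \<subseteq> V"
        using exclusive_subset[of A K u] AV[of u] by blast
    next
      fix u v assume "u \<in> set ws" "v \<in> set ws" "u \<noteq> v"
      then show "exclusive A K u \<inter> exclusive A K v = {}"
        using ws(2) by (intro exclusive_disjoint) auto
    next
      have "z \<in> A u" if "u \<in> K" for u using UA[of u] that K(1) z by blast
      then have "z \<in> A a" "z \<in> A b" using J(1) by blast+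
      then have "z \<notin> exclusive A K u" for u
        using J(1,2) unfolding exclusive_def by (cases "u = a") auto
      then show "V - \<Union> (exclusive A K ` set ws) \<noteq> {}" using z(1) by blast
    qed
    then show ?thesis using opt ws(3) k by simp
  qed
  \<comment> \<open>Each half has \<open>k - 1\<close> exclusive parts, which with the remainder
    make \<open>k\<close> parts.\<close>
  let ?us = "take (k - 1) us" and ?vs = "drop (k - 1) us"
  have "set ?us \<inter> set ?vs = {}" using us(1) set_take_disj_set_drop_if_distinct by blast
  moreover have "set ?us \<subseteq> K" "set ?vs \<subseteq> K" using us(2) set_take_subset set_drop_subset by fast+
  moreover have "length ?us = k - 1" "length ?vs = k - 1" using lus by auto
  ultimately have "part_cost E P + part_cost E P \<le> (\<Sum>e\<in>#E. weight A K e)"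
    using star[of ?us] star[of ?vs] star_partitions_cost_le[of ?us ?vs K E V A] us(1) by simp
  then show False using lt cut_val_le_part_cost[OF part, of E] k by simp
qed

theorem theorem1p2:
  fixes V :: "'a set" and E :: "'a set multiset" and k :: nat and P :: "'a set list" and T :: "'a set"
  assumes "hypergraph V E"
    and "k \<ge> 2"
    and "max_min_kpart V E k P"
    and "card (P ! 0) \<ge> 2 * k - 2"
    and "T \<subseteq> V - P ! 0"
    and "\<forall>j\<in>{1..<k}. T \<inter> P ! j \<noteq> {}"
  shows "\<exists>S \<subseteq> P ! 0. card S = 2 * k - 2 \<and> source_max_min_terminal_cut V E S T (P ! 0)"
proof -
  let ?U = "P ! 0"
  have P: "min_kpart V E k P" using assms(3) unfolding max_min_kpart_def by blast
  then have "?U \<in> set P" "\<Union> (set P) = V" using assms(2) unfolding min_kpart_def is_partition_def by auto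
  then have UV: "?U \<subseteq> V - T" using assms(5) by blast
  have finU: "finite ?U" using UV assms(1) unfolding hypergraph_def by (meson Diff_subset finite_subset)
  define good where
    "good S \<longleftrightarrow> S \<subseteq> ?U \<and> (\<forall>X. S \<subseteq> X \<longrightarrow> X \<subseteq> ?U \<longrightarrow> cut_val V E ?U \<le> cut_val V E X)" for S
  have "good ?U" unfolding good_def by auto
  then obtain S where S: "good S" "\<And>S'. good S' \<Longrightarrow> card S \<le> card S'"
    using ex_has_least_nat[of good ?U card] by blast
  have finS: "finite S" using S(1) finU unfolding good_def by (meson finite_subset)
  have "card S < 2 * k - 2"
  proof (rule min_kpart_witness_card[OF assms(1,2) P])
    show "S \<subseteq> ?U" using S(1) unfolding good_def by blast
    show "cut_val V E ?U \<le> cut_val V E X" if "S \<subseteq> X" "X \<subseteq> ?U" for X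
      using S(1) that unfolding good_def by blast
    fix u assume "u \<in> S"
    then have "\<not> good (S - {u})" using S(2)[of "S - {u}"] finS by (metis card_Diff1_less not_le)
    then show "\<exists>X. S - {u} \<subseteq> X \<and> X \<subseteq> ?U \<and> cut_val V E X < cut_val V E ?U"
      using S(1) unfolding good_def by (metis Diff_subset not_le order_trans)
  qed
  \<comment> \<open>Goodness passes to larger subsets of \<open>?U\<close>, as fewer sets
    \<open>X\<close> have to be tested, so \<open>S\<close> may be padded to the exact size.\<close>
  then obtain S' where S': "S \<subseteq> S'" "S' \<subseteq> ?U" "card S' = 2 * k - 2"
    using exists_subset_between[of S "2 * k - 2" ?U] S(1) assms(4) finU unfolding good_def by auto
  have "source_max_min_terminal_cut V E S' T ?U"
  proof (rule source_max_min_terminal_cutI[OF assms(1) S'(2) UV])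
    show "cut_val V E ?U \<le> cut_val V E X" if "S' \<subseteq> X" "X \<subseteq> ?U" for X
      using S(1) S'(1) that unfolding good_def by blast
    show "cut_val V E ?U < cut_val V E X" if "?U \<subset> X" "X \<subseteq> V - T" for X
      using cut_val_less_of_superset[OF assms(1) _ assms(3) that assms(6)] assms(2) by simp
  qed
  then show ?thesis using S' by blast
qed

end
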